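(* Let $\Gamma$ be a finite simplicial graph with edges labeled by integers $\geq 2$, and let $G = G_{\Gamma}$ be the associated Artin group. Suppose that $$\Sigma^1(G)=\{[\chi]\in S(G) \mid \mathcal{L}(\chi) \text{ is a connected dominant subgraph of } \Gamma \}.$$ Then there exist finitely many subgroups $H_1, \ldots, H_s$ of $G$ such that $$\Sigma^1(G)^c = \bigcup_{1 \leq i \leq s} S(G, H_i),$$ where $\Sigma^1(G)^c = S(G)\setminus \Sigma^1(G)$. In particular, $\Sigma^1(G)^c$ is a rationally defined spherical polyhedron.
   Context: Artin groups. For a finite simplicial graph $\Gamma$ with vertex set $V(\Gamma)$, edge set $E(\Gamma)$ and edges labeled by integers $\geq 2$, the Artin group $G_\Gamma$ is generated by $V(\Gamma)$ with one relation $$\underbrace{uvu\cdots}_{n \text{ factors}}=\underbrace{vuv\cdots}_{n \text{ factors}}$$ for every edge of $\Gamma$ with vertices $u,v$ and label $n$. Characters and $\Sigma^1$. For a finitely generated group $G$, $S(G)$ is the set of equivalence classes $[\chi]$ of non-zero homomorphisms $\chi: G\to\mathbb{R}$, where $\chi_1\sim\chi_2$ if and only if $\chi_1=r\chi_2$ for some real $r>0$. Put $G_\chi=\{g\in G\mid \chi(g)\ge 0\}$. Fix a finite generating set $Y$ of $G$ and the Cayley graph of $G$ with vertex set $G$ and edges joining $g$ to $gy$ ($g\in G$, $y\in Y$). Then $[\chi]\in\Sigma^1(G)$ if and only if the full subgraph of the Cayley graph spanned by the vertices in $G_\chi$ is connected (this does not depend on the choice of $Y$). For a subgroup $H$ of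 $G$, $S(G,H)=\{[\chi]\in S(G)\mid \chi(H)=0\}$. Rationally defined spherical polyhedra. Let $n$ be the torsion-free rank of $G/G'$; choosing a basis of $G/G'$ modulo torsion identifies $\mathrm{Hom}(G,\mathbb{R})$ with $\mathbb{R}^n$ and $S(G)$ with the unit sphere $\mathbb{S}^{n-1}$. A rationally defined closed semi-sphere is a set $\{x\in \mathbb{S}^{n-1}\mid \langle x,q\rangle\ge 0\}$ for a vector $q\in\mathbb{R}^n$ with rational coordinates. A rationally defined spherical polyhedron is a finite union of finite intersections of rationally defined closed semi-spheres. Living subgraph. Let $\chi:G_\Gamma\to\mathbb{R}$ be a non-zero character. An edge $e\in E(\Gamma)$ with vertices $u,v$ is dead if $\chi(u)=-\chi(v)$ and $e$ has an even label greater than $2$. Let $\mathcal{L}_{\mathcal{F}}(\chi)$ be the full (induced) subgraph of $\Gamma$ on the vertices $v\in V(\Gamma)$ with $\chi(v)\neq 0$. The living subgraph $\mathcal{L}(\chi)$ is obtained from $\mathcal{L}_{\mathcal{F}}(\chi)$ by removing all dead edges (keeping all vertices). Dominance. A subgraph $\Gamma_0$ of $\Gamma$ is dominant if for each $v\in V(\Gamma)\setminus V(\Gamma_0)$ there is an edge $e\in E(\Gamma)$ that links $v$ with a vertex of $V(\Gamma_0)$. *)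

theory Defs
  imports
    Complex_Main
    "HOL-Algebra.Algebra"
    "Graph_Theory.Graph_Theory"
    "Jordan_Normal_Form.Matrix"
begin

section \<open>Group presentations\<close>

text \<open>In a word, the letter \<open>(x, True)\<close> stands for the generator \<open>x\<close> and
  \<open>(x, False)\<close> for its formal inverse.\<close>

type_synonym 'a gword = "('a \<times> bool) list"

abbreviation gwords :: "'a set \<Rightarrow> 'a gword set" where
  "gwords S \<equiv> lists (S \<times> UNIV)"

text \<open>The congruence on words over \<open>S\<close> generated by free cancellation and the relators;
  a pair \<open>(u, v)\<close> in \<open>R\<close> stands for the relation \<open>u = v\<close>.\<close>

inductive_set presentation_rel :: "'a set \<Rightarrow> ('a gword \<times> 'a gword) set \<Rightarrow> ('a gword \<times> 'a gword) set"
  for S R where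
  refl: "w \<in> gwords S \<Longrightarrow> (w, w) \<in> presentation_rel S R"
| sym: "(u, v) \<in> presentation_rel S R \<Longrightarrow> (v, u) \<in> presentation_rel S R"
| trans: "(u, v) \<in> presentation_rel S R \<Longrightarrow> (v, w) \<in> presentation_rel S R \<Longrightarrow>
    (u, w) \<in> presentation_rel S R"
| cong: "(u, v) \<in> presentation_rel S R \<Longrightarrow> p \<in> gwords S \<Longrightarrow> q \<in> gwords S \<Longrightarrow>
    (p @ u @ q, p @ v @ q) \<in> presentation_rel S R"
| cancel: "x \<in> S \<Longrightarrow> ([(x, b), (x, \<not> b)], []) \<in> presentation_rel S R"
| relation: "(u, v) \<in> R \<Longrightarrow> u \<in> gwords S \<Longrightarrow> v \<in> gwords S \<Longrightarrow>
    (u, v) \<in> presentation_rel S R"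

definition presented_group :: "'a set \<Rightarrow> ('a gword \<times> 'a gword) set \<Rightarrow> 'a gword set monoid" where
  "presented_group S R =
     \<lparr>carrier = gwords S // presentation_rel S R,
      monoid.mult = (\<lambda>A B. \<Union>a\<in>A. \<Union>b\<in>B. presentation_rel S R `` {a @ b}),
      one = presentation_rel S R `` {[]}\<rparr>"

lemma presentation_rel_gwords:
  "(u, v) \<in> presentation_rel S R \<Longrightarrow> u \<in> gwords S \<and> v \<in> gwords S"
  by (induction rule: presentation_rel.induct) auto

lemma equiv_presentation_rel: "equiv (gwords S) (presentation_rel S R)"
proof (rule equivI)
  show "presentation_rel S R \<subseteq> gwords S \<times> gwords S"
    by (clarify, drule presentation_rel_gwords, simp)
  show "refl_on (gwords S) (presentation_rel S R)"
    by (simp add: refl_on_def presentation_rel.refl)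
  show "sym (presentation_rel S R)"
    by (rule symI) (rule presentation_rel.sym)
  show "trans (presentation_rel S R)"
    by (rule transI) (rule presentation_rel.trans)
qed

lemma presentation_rel_append:
  assumes "(u, u') \<in> presentation_rel S R" "(v, v') \<in> presentation_rel S R"
  shows "(u @ v, u' @ v') \<in> presentation_rel S R"
proof -
  have "(u @ v, u' @ v) \<in> presentation_rel S R"
    using presentation_rel.cong[OF assms(1), of "[]" v] presentation_rel_gwords[OF assms(2)] by simp
  moreover have "(u' @ v, u' @ v') \<in> presentation_rel S R"
    using presentation_rel.cong[OF assms(2), of u' "[]"] presentation_rel_gwords[OF assms(1)] by simp
  ultimately show ?thesis by (rule presentation_rel.trans)
qed

lemma presented_group_mult:
  assumes "u \<in> gwords S" "v \<in> gwords S"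
  shows "presentation_rel S R `` {u} \<otimes>\<^bsub>presented_group S R\<^esub> presentation_rel S R `` {v} =
    presentation_rel S R `` {u @ v}"
proof -
  have "presentation_rel S R `` {a @ b} = presentation_rel S R `` {u @ v}"
    if "(u, a) \<in> presentation_rel S R" "(v, b) \<in> presentation_rel S R" for a b
    by (rule equiv_class_eq[OF equiv_presentation_rel, symmetric])
      (rule presentation_rel_append[OF that])
  moreover have "u \<in> presentation_rel S R `` {u}" "v \<in> presentation_rel S R `` {v}"
    using assms by (simp_all add: presentation_rel.refl)
  ultimately have "(\<Union>a\<in>presentation_rel S R `` {u}. \<Union>b\<in>presentation_rel S R `` {v}.
      presentation_rel S R `` {a @ b}) = presentation_rel S R `` {u @ v}"
    by blast
  then show ?thesis by (simp add: presented_group_def)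
qed

lemma presentation_rel_inverse:
  "w \<in> gwords S \<Longrightarrow> (rev (map (\<lambda>(x, b). (x, \<not> b)) w) @ w, []) \<in> presentation_rel S R"
proof (induction w)
  case Nil
  then show ?case by (auto intro: presentation_rel.refl)
next
  case (Cons a w)
  obtain x b where a: "a = (x, b)" by (cases a)
  let ?i = "\<lambda>w. rev (map (\<lambda>(x, b). (x, \<not> b)) w)"
  have w: "w \<in> gwords S" "x \<in> S" using Cons.prems a by auto
  then have iw: "?i w \<in> gwords S" by (auto simp: lists_eq_set)
  have "([(x, \<not> b), (x, b)], []) \<in> presentation_rel S R"
    using presentation_rel.cancel[OF w(2), of "\<not> b" R] by simp
  from presentation_rel.cong[OF this iw w(1)]
  have "(?i (a # w) @ a # w, ?i w @ w) \<in> presentation_rel S R" by (simp add: a)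
  then show ?case using Cons.IH[OF w(1)] by (rule presentation_rel.trans)
qed

lemma group_presented_group: "group (presented_group S R)"
proof (rule groupI)
  let ?G = "presented_group S R" and ?c = "\<lambda>w. presentation_rel S R `` {w}"
  have carr: "carrier ?G = ?c ` gwords S" and one: "\<one>\<^bsub>?G\<^esub> = ?c []"
    by (auto simp: presented_group_def quotient_def)
  note m = presented_group_mult[of _ S _ R]
  show "\<one>\<^bsub>?G\<^esub> \<in> carrier ?G" by (auto simp: carr one)
  fix x assume "x \<in> carrier ?G"
  then obtain u where u: "u \<in> gwords S" "x = ?c u" by (auto simp: carr)
  show "\<one>\<^bsub>?G\<^esub> \<otimes>\<^bsub>?G\<^esub> x = x"
    using m[of "[]" u] u by (simp add: one)
  let ?iu = "rev (map (\<lambda>(x, b). (x, \<not> b)) u)"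
  have iu: "?iu \<in> gwords S" using u(1) by (auto simp: lists_eq_set)
  have "?c (?iu @ u) = ?c []"
    using equiv_class_eq[OF equiv_presentation_rel presentation_rel_inverse[OF u(1)]] .
  then show "\<exists>y\<in>carrier ?G. y \<otimes>\<^bsub>?G\<^esub> x = \<one>\<^bsub>?G\<^esub>"
    using m[OF iu u(1)] iu by (auto simp: u(2) one carr)
  fix y assume "y \<in> carrier ?G"
  then obtain v where v: "v \<in> gwords S" "y = ?c v" by (auto simp: carr)
  show "x \<otimes>\<^bsub>?G\<^esub> y \<in> carrier ?G"
    using m[of u v] u v by (auto simp: carr)
  fix z assume "z \<in> carrier ?G"
  then obtain w where w: "w \<in> gwords S" "z = ?c w" by (auto simp: carr)
  show "x \<otimes>\<^bsub>?G\<^esub> y \<otimes>\<^bsub>?G\<^esub> z = x \<otimes>\<^bsub>?G\<^esub> (y \<otimes>\<^bsub>?G\<^esub> z)"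
    using u v w m[of "u @ v" w] m[of u "v @ w"] m[of u v] m[of v w] by simp
qed


section \<open>Artin groups\<close>

text \<open>A finite simplicial graph is a \<^const>\<open>pair_graph\<close>: an edge with vertices \<open>u\<close>, \<open>v\<close> is
  represented by the two arcs \<open>(u, v)\<close> and \<open>(v, u)\<close>, and its label is \<open>l u v = l v u\<close>.\<close>

fun alternating_word :: "'a \<Rightarrow> 'a \<Rightarrow> nat \<Rightarrow> 'a gword" where
  "alternating_word u v 0 = []"
| "alternating_word u v (Suc n) = (u, True) # alternating_word v u n"

definition artin_relations ::
    "'a pair_pre_digraph \<Rightarrow> ('a \<Rightarrow> 'a \<Rightarrow> nat) \<Rightarrow> ('a gword \<times> 'a gword) set" where
  "artin_relations \<Gamma> l =
     {(alternating_word u v (l u v), alternating_word v u (l u v)) | u v. (u, v) \<in> parcs \<Gamma>}"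

definition artin_group :: "'a pair_pre_digraph \<Rightarrow> ('a \<Rightarrow> 'a \<Rightarrow> nat) \<Rightarrow> 'a gword set monoid" where
  "artin_group \<Gamma> l = presented_group (pverts \<Gamma>) (artin_relations \<Gamma> l)"

definition artin_gen :: "'a pair_pre_digraph \<Rightarrow> ('a \<Rightarrow> 'a \<Rightarrow> nat) \<Rightarrow> 'a \<Rightarrow> 'a gword set" where
  "artin_gen \<Gamma> l v = presentation_rel (pverts \<Gamma>) (artin_relations \<Gamma> l) `` {[(v, True)]}"

lemma group_artin_group: "group (artin_group \<Gamma> l)"
  unfolding artin_group_def by (rule group_presented_group)


section \<open>Characters and the invariant \<open>\<Sigma>\<^sup>1\<close>\<close>

definition real_group :: "real monoid" where
  "real_group = \<lparr>carrier = UNIV, monoid.mult = (+), one = 0\<rparr>"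

definition nonzero_characters :: "('g, 'm) monoid_scheme \<Rightarrow> ('g \<Rightarrow> real) set" where
  "nonzero_characters G = {\<chi> \<in> hom G real_group. \<exists>g\<in>carrier G. \<chi> g \<noteq> 0}"

text \<open>Functions are compared on the carrier only, so the values of a character outside the
  carrier, which \<^const>\<open>hom\<close> leaves unconstrained, do not affect its class.\<close>

definition character_rel :: "('g, 'm) monoid_scheme \<Rightarrow> (('g \<Rightarrow> real) \<times> ('g \<Rightarrow> real)) set" where
  "character_rel G = {(\<chi>1, \<chi>2). \<chi>1 \<in> nonzero_characters G \<and> \<chi>2 \<in> nonzero_characters G \<and>
     (\<exists>r>0. \<forall>g\<in>carrier G. \<chi>1 g = r * \<chi>2 g)}"

abbreviation character_class ::
    "('g, 'm) monoid_scheme \<Rightarrow> ('g \<Rightarrow> real) \<Rightarrow> ('g \<Rightarrow> real) set" where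
  "character_class G \<chi> \<equiv> character_rel G `` {\<chi>}"

definition character_sphere :: "('g, 'm) monoid_scheme \<Rightarrow> ('g \<Rightarrow> real) set set" where
  "character_sphere G = nonzero_characters G // character_rel G"

text \<open>\<open>S(G, H)\<close>\<close>

definition character_subsphere ::
    "('g, 'm) monoid_scheme \<Rightarrow> 'g set \<Rightarrow> ('g \<Rightarrow> real) set set" where
  "character_subsphere G H =
     {character_class G \<chi> | \<chi>. \<chi> \<in> nonzero_characters G \<and> (\<forall>h\<in>H. \<chi> h = 0)}"

definition cayley_graph :: "('g, 'm) monoid_scheme \<Rightarrow> 'g set \<Rightarrow> 'g pair_pre_digraph" where
  "cayley_graph G Y =
     \<lparr>pverts = carrier G, parcs = {(g, g \<otimes>\<^bsub>G\<^esub> y) | g y. g \<in> carrier G \<and> y \<in> Y}\<rparr>"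

text \<open>The predicate \<^const>\<open>Digraph_Component.connected\<close> ignores the orientation of arcs. It is
  qualified because the topological notion has the same name. The parameter \<open>Y\<close> is the chosen
  finite generating set.\<close>

definition Sigma1 :: "('g, 'm) monoid_scheme \<Rightarrow> 'g set \<Rightarrow> ('g \<Rightarrow> real) set set" where
  "Sigma1 G Y = {character_class G \<chi> | \<chi>. \<chi> \<in> nonzero_characters G \<and>
     Digraph_Component.connected (with_proj (cayley_graph G Y) \<restriction> {g \<in> carrier G. \<chi> g \<ge> 0})}"


section \<open>Living subgraphs and dominance\<close>

definition dead_edge ::
    "'a pair_pre_digraph \<Rightarrow> ('a \<Rightarrow> 'a \<Rightarrow> nat) \<Rightarrow> ('a gword set \<Rightarrow> real) \<Rightarrow> 'a \<Rightarrow> 'a \<Rightarrow> bool" where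
  "dead_edge \<Gamma> l \<chi> u v \<longleftrightarrow> (u, v) \<in> parcs \<Gamma> \<and>
     \<chi> (artin_gen \<Gamma> l u) = - \<chi> (artin_gen \<Gamma> l v) \<and> even (l u v) \<and> l u v > 2"

definition living_subgraph ::
    "'a pair_pre_digraph \<Rightarrow> ('a \<Rightarrow> 'a \<Rightarrow> nat) \<Rightarrow> ('a gword set \<Rightarrow> real) \<Rightarrow> 'a pair_pre_digraph" where
  "living_subgraph \<Gamma> l \<chi> =
     \<lparr>pverts = {v \<in> pverts \<Gamma>. \<chi> (artin_gen \<Gamma> l v) \<noteq> 0},
      parcs = {(u, v) \<in> parcs \<Gamma>. \<chi> (artin_gen \<Gamma> l u) \<noteq> 0 \<and> \<chi> (artin_gen \<Gamma> l v) \<noteq> 0 \<and>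
                 \<not> dead_edge \<Gamma> l \<chi> u v}\<rparr>"

definition dominant :: "'a pair_pre_digraph \<Rightarrow> 'a pair_pre_digraph \<Rightarrow> bool" where
  "dominant \<Gamma>0 \<Gamma> \<longleftrightarrow> (\<forall>v \<in> pverts \<Gamma> - pverts \<Gamma>0. \<exists>w \<in> pverts \<Gamma>0. (v, w) \<in> parcs \<Gamma>)"


section \<open>Rationally defined spherical polyhedra\<close>

definition unit_sphere :: "nat \<Rightarrow> real vec set" where
  "unit_sphere n = {x \<in> carrier_vec n. x \<bullet> x = 1}"

definition rational_semisphere :: "nat \<Rightarrow> real vec set \<Rightarrow> bool" where
  "rational_semisphere n S \<longleftrightarrow>
     (\<exists>q \<in> carrier_vec n. (\<forall>i<n. q $ i \<in> \<rat>) \<and> S = {x \<in> unit_sphere n. x \<bullet> q \<ge> 0})"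

text \<open>The families \<open>F\<close> are required to be nonempty because \<open>\<Inter>{}\<close> is the universe of the type
  and not the sphere; the whole sphere is itself a semi-sphere, with \<open>q = 0\<close>.\<close>

definition rational_spherical_polyhedron :: "nat \<Rightarrow> real vec set \<Rightarrow> bool" where
  "rational_spherical_polyhedron n P \<longleftrightarrow>
     (\<exists>\<F>. finite \<F> \<and> (\<forall>F\<in>\<F>. finite F \<and> F \<noteq> {} \<and> (\<forall>S\<in>F. rational_semisphere n S)) \<and>
          P = (\<Union>F\<in>\<F>. \<Inter>F))"

definition torsion :: "('g, 'm) monoid_scheme \<Rightarrow> 'g set" where
  "torsion A = {a \<in> carrier A. \<exists>m::nat. m > 0 \<and> a [^]\<^bsub>A\<^esub> m = \<one>\<^bsub>A\<^esub>}"

definition abelianization :: "('g, 'm) monoid_scheme \<Rightarrow> 'g set monoid" where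
  "abelianization G = G Mod derived G (carrier G)"

definition abelianization_mod_torsion :: "('g, 'm) monoid_scheme \<Rightarrow> 'g set set monoid" where
  "abelianization_mod_torsion G = abelianization G Mod torsion (abelianization G)"

definition to_abelianization_mod_torsion :: "('g, 'm) monoid_scheme \<Rightarrow> 'g \<Rightarrow> 'g set set" where
  "to_abelianization_mod_torsion G g =
     torsion (abelianization G) #>\<^bsub>abelianization G\<^esub> (derived G (carrier G) #>\<^bsub>G\<^esub> g)"

text \<open>A basis of \<open>G/G'\<close> modulo torsion is given by a list of representatives in \<open>G\<close> of its
  elements; its length is the torsion-free rank of \<open>G/G'\<close>.\<close>

definition basis_mod_torsion :: "('g, 'm) monoid_scheme \<Rightarrow> 'g list \<Rightarrow> bool" where
  "basis_mod_torsion G bs \<longleftrightarrow> set bs \<subseteq> carrier G \<and>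
     (\<forall>x \<in> carrier (abelianization_mod_torsion G).
        \<exists>!k. k \<in> {..<length bs} \<rightarrow>\<^sub>E (UNIV :: int set) \<and>
          x = (\<Otimes>\<^bsub>abelianization_mod_torsion G\<^esub> i\<in>{..<length bs}.
                 to_abelianization_mod_torsion G (bs ! i) [^]\<^bsub>abelianization_mod_torsion G\<^esub> k i))"

text \<open>Since characters vanish on \<open>G'\<close> and on torsion, the coordinates of \<open>\<chi>\<close> with respect to the
  basis are its values on the representatives. A class of characters is identified with the
  coordinate vector of its member of norm 1.\<close>

definition spherical_coordinates ::
    "'g list \<Rightarrow> ('g \<Rightarrow> real) set set \<Rightarrow> real vec set" where
  "spherical_coordinates bs C =
     {x \<in> unit_sphere (length bs). \<exists>c\<in>C. \<exists>\<chi>\<in>c. x = vec_of_list (map \<chi> bs)}"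

end

theory Submission
  imports Defs
begin

text \<open>For a character \<open>\<chi>\<close> let \<open>H\<^sub>\<chi>\<close> be generated by the \<open>v\<close> with \<open>\<chi> v = 0\<close> and the
  products \<open>u v\<close> over the dead edges of \<open>\<chi>\<close>; only finitely many \<open>H\<^sub>\<chi>\<close> occur. If \<open>\<chi>'\<close> vanishes
  on \<open>H\<^sub>\<chi>\<close>, then \<open>\<L>(\<chi>')\<close> is a subgraph of \<open>\<L>(\<chi>)\<close>. Moreover, if \<open>\<L>(\<chi>')\<close> is connected and
  dominant, then so is \<open>\<L>(\<chi>)\<close>: a vertex of \<open>\<L>(\<chi>)\<close> outside \<open>\<L>(\<chi>')\<close> has a neighbour in
  \<open>\<L>(\<chi>')\<close>, and the edge between them cannot be dead for \<open>\<chi>\<close>, since \<open>\<chi>'\<close> vanishes at exactly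
  one of its ends. Hence the complement of \<open>\<Sigma>\<^sup>1\<close> is the union of the \<open>S(G, H\<^sub>\<chi>)\<close> over the
  \<open>[\<chi>]\<close> outside \<open>\<Sigma>\<^sup>1\<close>. In coordinates, \<open>\<chi> g = 0\<close> is a linear equation with integer
  coefficients, that is, a pair of opposite rational semi-spheres.\<close>


section \<open>Homomorphisms into the reals\<close>

lemma real_group_simps [simp]:
  "carrier real_group = UNIV" "x \<otimes>\<^bsub>real_group\<^esub> y = x + y" "\<one>\<^bsub>real_group\<^esub> = 0"
  by (simp_all add: real_group_def)

lemma comm_group_real_group: "comm_group real_group"
proof (rule comm_groupI)
  show "\<exists>y\<in>carrier real_group. y \<otimes>\<^bsub>real_group\<^esub> x = \<one>\<^bsub>real_group\<^esub>" for x
    by (rule bexI[of _ "- x"]) simp_all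
qed simp_all

interpretation real_group: comm_group real_group
  by (rule comm_group_real_group)

lemma inv_real_group [simp]: "inv\<^bsub>real_group\<^esub> x = - x"
  by (rule real_group.inv_equality) simp_all

lemma nat_pow_real_group: "x [^]\<^bsub>real_group\<^esub> (k::nat) = of_nat k * x"
  by (induction k) (simp_all add: algebra_simps)

lemma int_pow_real_group: "x [^]\<^bsub>real_group\<^esub> (k::int) = of_int k * x"
  by (simp add: int_pow_def2 nat_pow_real_group)

lemma finprod_real_group: "finprod real_group f A = sum f A"
  by (induction A rule: infinite_finite_induct) (simp_all add: real_group.finprod_insert)

lemma hom_finprod:
  assumes "comm_group G" "comm_group H" "h \<in> hom G H" "f \<in> A \<rightarrow> carrier G"
  shows "h (finprod G f A) = finprod H (\<lambda>i. h (f i)) A"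
proof -
  interpret G: comm_group G by fact
  interpret H: comm_group H by fact
  interpret group_hom G H h by unfold_locales fact
  show ?thesis using assms(4)
  proof (induction A rule: infinite_finite_induct)
    case (insert i A)
    then have "f \<in> A \<rightarrow> carrier G" "f i \<in> carrier G" by auto
    moreover from this have "(\<lambda>i. h (f i)) \<in> A \<rightarrow> carrier H"
      by (auto simp: Pi_iff)
    ultimately show ?case using insert by simp
  qed simp_all
qed

lemma (in group) real_hom_mult:
  "\<chi> \<in> hom G real_group \<Longrightarrow> x \<in> carrier G \<Longrightarrow> y \<in> carrier G \<Longrightarrow> \<chi> (x \<otimes> y) = \<chi> x + \<chi> y"
  by (simp add: hom_mult)

lemma (in group) group_hom_real:
  "\<chi> \<in> hom G real_group \<Longrightarrow> group_hom G real_group \<chi>"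
  by unfold_locales

lemma (in group) real_hom_zero_on_generate:
  assumes "\<chi> \<in> hom G real_group" "A \<subseteq> carrier G" "\<And>a. a \<in> A \<Longrightarrow> \<chi> a = 0" "g \<in> generate G A"
  shows "\<chi> g = 0"
proof -
  interpret group_hom G real_group \<chi> using assms(1) by (rule group_hom_real)
  have "A \<subseteq> kernel G real_group \<chi>"
    using assms(2,3) by (auto simp: kernel_def)
  then have "generate G A \<subseteq> kernel G real_group \<chi>"
    by (rule generate_subgroup_incl) (rule subgroup_kernel)
  then show ?thesis using assms(4) by (auto simp: kernel_def)
qed


section \<open>The abelianization modulo torsion\<close>

text \<open>Commutativity splits a power of a product, so the product of an exponent killing
  \<open>a\<close> and one killing \<open>b\<close> kills \<open>a \<otimes> b\<close>.\<close>

lemma (in comm_group) subgroup_torsion: "subgroup (torsion G) G"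
proof (rule subgroupI)
  have "\<one> [^] (1::nat) = \<one>" by simp
  then show "torsion G \<noteq> {}" unfolding torsion_def by blast
  show "inv a \<in> torsion G" if "a \<in> torsion G" for a
    using that by (auto simp: torsion_def nat_pow_inv)
  show "a \<otimes> b \<in> torsion G" if ab: "a \<in> torsion G" "b \<in> torsion G" for a b
  proof -
    from ab obtain m n :: nat where *: "m > 0" "a [^] m = \<one>" "n > 0" "b [^] n = \<one>"
      and c: "a \<in> carrier G" "b \<in> carrier G"
      by (auto simp: torsion_def)
    have "(a \<otimes> b) [^] (m * n) = (a [^] m) [^] n \<otimes> (b [^] n) [^] m"
      using c by (simp add: nat_pow_distrib nat_pow_pow mult.commute)
    then have "(a \<otimes> b) [^] (m * n) = \<one>" using * by simp
    moreover have "m * n > 0" using * by simp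
    ultimately show ?thesis using c unfolding torsion_def by blast
  qed
qed (auto simp: torsion_def)

context group
begin

lemma comm_group_abelianization: "comm_group (abelianization G)"
  unfolding abelianization_def by (rule derived_quot_is_comm_group)

lemma torsion_normal: "torsion (abelianization G) \<lhd> abelianization G"
  using comm_group.subgroup_torsion comm_group.normal_iff_subgroup comm_group_abelianization
  by blast

lemma comm_group_abelianization_mod_torsion: "comm_group (abelianization_mod_torsion G)"
  unfolding abelianization_mod_torsion_def
  using comm_group.subgroup_torsion comm_group.abelian_FactGroup comm_group_abelianization
  by blast

lemma to_abelianization_mod_torsion_hom:
  "to_abelianization_mod_torsion G \<in> hom G (abelianization_mod_torsion G)"
proof -
  have "(\<lambda>g. derived G (carrier G) #> g) \<in> hom G (abelianization G)"
    unfolding abelianization_def by (rule normal.r_coset_hom_Mod[OF derived_self_is_normal])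
  from Group.hom_compose[OF this normal.r_coset_hom_Mod[OF torsion_normal]]
  show ?thesis
    by (simp add: abelianization_mod_torsion_def to_abelianization_mod_torsion_def[abs_def] comp_def)
qed

lemma real_hom_zero_on_derived:
  assumes "\<chi> \<in> hom G real_group"
  shows "derived G (carrier G) \<subseteq> kernel G real_group \<chi>"
proof -
  interpret group_hom G real_group \<chi> using assms by (rule group_hom_real)
  show ?thesis
    unfolding derived_def
    by (rule generate_subgroup_incl[OF _ subgroup_kernel]) (auto simp: kernel_def)
qed

lemma real_hom_zero_on_torsion:
  assumes "\<chi> \<in> hom G real_group"
  shows "torsion G \<subseteq> kernel G real_group \<chi>"
proof
  interpret group_hom G real_group \<chi> using assms by (rule group_hom_real)
  fix a assume "a \<in> torsion G"
  then obtain m :: nat where m: "m > 0" "a [^] m = \<one>" and a: "a \<in> carrier G"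
    by (auto simp: torsion_def)
  have "of_nat m * \<chi> a = 0"
    using hom_nat_pow[OF a, of m] m by (simp add: nat_pow_real_group)
  then show "a \<in> kernel G real_group \<chi>" using m a by (simp add: kernel_def)
qed

text \<open>The reals are abelian and torsion-free, so the universal property of the quotient
  applies twice: first to the derived subgroup, then to the torsion of the abelianization.\<close>

lemma real_hom_factors:
  assumes "\<chi> \<in> hom G real_group"
  obtains \<psi> where "\<psi> \<in> hom (abelianization_mod_torsion G) real_group"
    "\<And>g. g \<in> carrier G \<Longrightarrow> \<psi> (to_abelianization_mod_torsion G g) = \<chi> g"
proof -
  let ?D = "derived G (carrier G)" and ?T = "torsion (abelianization G)"
  obtain \<phi> where \<phi>: "\<phi> \<in> hom (abelianization G) real_group"
      "\<And>g. g \<in> carrier G \<Longrightarrow> \<phi> (?D #> g) = \<chi> g"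
    using group_hom.FactGroup_universal_kernel[OF group_hom_real derived_self_is_normal
        real_hom_zero_on_derived] assms
    unfolding abelianization_def by blast
  interpret A: comm_group "abelianization G" by (rule comm_group_abelianization)
  obtain \<psi> where "\<psi> \<in> hom (abelianization_mod_torsion G) real_group"
      "\<And>a. a \<in> carrier (abelianization G) \<Longrightarrow> \<psi> (?T #>\<^bsub>abelianization G\<^esub> a) = \<phi> a"
    using group_hom.FactGroup_universal_kernel[OF A.group_hom_real torsion_normal
        A.real_hom_zero_on_torsion] \<phi>(1)
    unfolding abelianization_mod_torsion_def by blast
  moreover have "?D #> g \<in> carrier (abelianization G)" if "g \<in> carrier G" for g
    using that by (auto simp: abelianization_def carrier_FactGroup)
  ultimately show thesis
    using that \<phi>(2) by (simp add: to_abelianization_mod_torsion_def)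
qed

end


section \<open>Coordinates with respect to a basis modulo torsion\<close>

text \<open>The description is meaningful when \<open>bs\<close> is a basis and \<open>x\<close>
  lies in the carrier; extensionality of \<open>k\<close> makes it unique as a function.\<close>

definition basis_coords ::
    "('g, 'm) monoid_scheme \<Rightarrow> 'g list \<Rightarrow> 'g set set \<Rightarrow> nat \<Rightarrow> int" where
  "basis_coords G bs x = (THE k. k \<in> {..<length bs} \<rightarrow>\<^sub>E (UNIV :: int set) \<and>
     x = (\<Otimes>\<^bsub>abelianization_mod_torsion G\<^esub> i\<in>{..<length bs}.
       to_abelianization_mod_torsion G (bs ! i) [^]\<^bsub>abelianization_mod_torsion G\<^esub> k i))"

locale group_with_basis = group G for G :: "('g, 'm) monoid_scheme" (structure) +
  fixes bs :: "'g list"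
  assumes basis: "basis_mod_torsion G bs"
begin

abbreviation "A \<equiv> abelianization_mod_torsion G"
abbreviation "\<pi> \<equiv> to_abelianization_mod_torsion G"
abbreviation "n \<equiv> length bs"

sublocale A: comm_group A
  by (rule comm_group_abelianization_mod_torsion)

sublocale \<pi>: group_hom G A \<pi>
  using to_abelianization_mod_torsion_hom by unfold_locales

lemma basis_closed [simp]: "i < n \<Longrightarrow> bs ! i \<in> carrier G"
  using basis by (auto simp: basis_mod_torsion_def)

lemma basis_ex1:
  "x \<in> carrier A \<Longrightarrow>
     \<exists>!k. k \<in> {..<n} \<rightarrow>\<^sub>E (UNIV :: int set) \<and> x = (\<Otimes>\<^bsub>A\<^esub> i\<in>{..<n}. \<pi> (bs ! i) [^]\<^bsub>A\<^esub> k i)"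
  using basis by (simp add: basis_mod_torsion_def)

lemma basis_coords_eq:
  assumes "x \<in> carrier A"
  shows "x = (\<Otimes>\<^bsub>A\<^esub> i\<in>{..<n}. \<pi> (bs ! i) [^]\<^bsub>A\<^esub> basis_coords G bs x i)"
  using theI'[OF basis_ex1[OF assms]] by (simp add: basis_coords_def)

lemma basis_coords_unique:
  assumes "x = (\<Otimes>\<^bsub>A\<^esub> i\<in>{..<n}. \<pi> (bs ! i) [^]\<^bsub>A\<^esub> (k i :: int))" "i < n"
  shows "basis_coords G bs x i = k i"
proof -
  \<comment> \<open>\<open>k\<close> is arbitrary outside \<open>{..<n}\<close>, whereas the
    uniqueness given by the basis concerns extensional functions; hence the restriction.\<close>
  have "x = (\<Otimes>\<^bsub>A\<^esub> i\<in>{..<n}. \<pi> (bs ! i) [^]\<^bsub>A\<^esub> restrict k {..<n} i)"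
    unfolding assms(1) by (rule A.finprod_cong') (auto)
  moreover have "x \<in> carrier A"
    unfolding assms(1) by (rule A.finprod_closed) auto
  ultimately have "basis_coords G bs x = restrict k {..<n}"
    unfolding basis_coords_def by (intro the1_equality[OF basis_ex1]) auto
  then show ?thesis using assms(2) by simp
qed

text \<open>Multiplying the two expansions adds exponents, and uniqueness identifies these sums as
  the coordinates.\<close>

lemma basis_coords_mult:
  assumes "x \<in> carrier A" "y \<in> carrier A" "i < n"
  shows "basis_coords G bs (x \<otimes>\<^bsub>A\<^esub> y) i = basis_coords G bs x i + basis_coords G bs y i"
proof (rule basis_coords_unique[OF _ assms(3)])
  let ?p = "\<lambda>x i. \<pi> (bs ! i) [^]\<^bsub>A\<^esub> basis_coords G bs x i"
  have "x \<otimes>\<^bsub>A\<^esub> y = (\<Otimes>\<^bsub>A\<^esub> i\<in>{..<n}. ?p x i) \<otimes>\<^bsub>A\<^esub> (\<Otimes>\<^bsub>A\<^esub> i\<in>{..<n}. ?p y i)"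
    using basis_coords_eq assms(1,2) by simp
  also have "\<dots> = (\<Otimes>\<^bsub>A\<^esub> i\<in>{..<n}. ?p x i \<otimes>\<^bsub>A\<^esub> ?p y i)"
    by (rule A.finprod_multf[symmetric]) auto
  also have "\<dots> = (\<Otimes>\<^bsub>A\<^esub> i\<in>{..<n}.
      \<pi> (bs ! i) [^]\<^bsub>A\<^esub> (basis_coords G bs x i + basis_coords G bs y i))"
    by (rule A.finprod_cong') (auto simp: A.int_pow_mult)
  finally show "x \<otimes>\<^bsub>A\<^esub> y = \<dots>" .
qed

lemma basis_coords_basis:
  assumes "i < n" "j < n"
  shows "basis_coords G bs (\<pi> (bs ! j)) i = of_bool (i = j)"
proof (rule basis_coords_unique[OF _ assms(1)])
  have "\<pi> (bs ! j) = (\<Otimes>\<^bsub>A\<^esub> i\<in>{..<n}. if j = i then \<pi> (bs ! i) else \<one>\<^bsub>A\<^esub>)"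
    using assms(2) by (intro A.finprod_singleton[symmetric]) auto
  also have "\<dots> = (\<Otimes>\<^bsub>A\<^esub> i\<in>{..<n}. \<pi> (bs ! i) [^]\<^bsub>A\<^esub> (of_bool (i = j) :: int))"
    by (rule A.finprod_cong') (auto simp: A.int_pow_1)
  finally show "\<pi> (bs ! j) = \<dots>" .
qed

text \<open>The map from the group to \<open>\<int>^n\<close> given by the basis, viewed in real
  space. Its integer entries make the later semi-spheres rational.\<close>

definition coord_vec :: "'g \<Rightarrow> real vec" where
  "coord_vec g = vec n (\<lambda>i. of_int (basis_coords G bs (\<pi> g) i))"

lemma coord_vec_carrier [simp]: "coord_vec g \<in> carrier_vec n"
  by (simp add: coord_vec_def)

lemma coord_vec_mult:
  assumes "g \<in> carrier G" "h \<in> carrier G"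
  shows "coord_vec (g \<otimes> h) = coord_vec g + coord_vec h"
  using assms by (intro eq_vecI) (simp_all add: coord_vec_def basis_coords_mult)

lemma coord_vec_basis: "j < n \<Longrightarrow> coord_vec (bs ! j) = unit_vec n j"
  by (intro eq_vecI) (auto simp: coord_vec_def basis_coords_basis)

text \<open>Expand \<open>\<pi> g\<close> in the basis and apply the homomorphism through which
  \<open>\<chi>\<close> factors. Thus vanishing at \<open>g\<close> becomes a linear equation in the
  coordinates of \<open>\<chi>\<close>.\<close>

lemma real_hom_eq_scalar_prod:
  assumes "\<chi> \<in> hom G real_group" "g \<in> carrier G"
  shows "\<chi> g = vec_of_list (map \<chi> bs) \<bullet> coord_vec g"
proof -
  obtain \<psi> where \<psi>: "\<psi> \<in> hom A real_group" "\<And>g. g \<in> carrier G \<Longrightarrow> \<psi> (\<pi> g) = \<chi> g"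
    using real_hom_factors[OF assms(1)] by blast
  interpret \<psi>: group_hom A real_group \<psi> using \<psi>(1) by (rule A.group_hom_real)
  let ?k = "basis_coords G bs (\<pi> g)"
  have "\<chi> g = \<psi> (\<Otimes>\<^bsub>A\<^esub> i\<in>{..<n}. \<pi> (bs ! i) [^]\<^bsub>A\<^esub> ?k i)"
    using \<psi>(2)[OF assms(2)] basis_coords_eq[of "\<pi> g"] assms(2) by simp
  also have "\<dots> = (\<Sum>i<n. \<psi> (\<pi> (bs ! i) [^]\<^bsub>A\<^esub> ?k i))"
    by (subst hom_finprod[OF A.comm_group_axioms comm_group_real_group \<psi>(1)])
      (auto simp: finprod_real_group)
  also have "\<dots> = (\<Sum>i<n. of_int (?k i) * \<chi> (bs ! i))"
    by (intro sum.cong) (simp_all add: \<psi>.hom_int_pow int_pow_real_group \<psi>(2))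
  also have "\<dots> = vec_of_list (map \<chi> bs) \<bullet> coord_vec g"
    by (simp add: scalar_prod_def coord_vec_def vec_of_list_index lessThan_atLeast0 mult.commute)
  finally show ?thesis .
qed

text \<open>Together with \<open>map_scalar_prod_basis\<close> this realizes every vector as the
  coordinate vector of a homomorphism.\<close>

lemma scalar_prod_hom:
  assumes "x \<in> carrier_vec n"
  shows "(\<lambda>g. x \<bullet> coord_vec g) \<in> hom G real_group"
  by (rule homI) (auto simp: coord_vec_mult scalar_prod_add_distrib[OF assms])

lemma map_scalar_prod_basis:
  assumes "x \<in> carrier_vec n"
  shows "vec_of_list (map (\<lambda>g. x \<bullet> coord_vec g) bs) = x"
  using assms
  by (intro eq_vecI) (auto simp: vec_of_list_index coord_vec_basis scalar_prod_right_unit)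

section \<open>Subspheres in coordinates and finite unions of them\<close>

lemma spherical_coordinates_subsphere:
  assumes "S \<subseteq> carrier G"
  shows "spherical_coordinates bs (character_subsphere G S) =
    {x \<in> unit_sphere n. \<forall>a\<in>S. x \<bullet> coord_vec a = 0}"
proof (intro equalityI subsetI)
  fix x assume "x \<in> spherical_coordinates bs (character_subsphere G S)"
  then obtain \<chi> \<chi>' where x: "x \<in> unit_sphere n" "x = vec_of_list (map \<chi>' bs)"
    and \<chi>: "\<forall>h\<in>S. \<chi> h = 0" and "(\<chi>, \<chi>') \<in> character_rel G"
    by (auto simp: spherical_coordinates_def character_subsphere_def)
  then obtain r where r: "r > 0" "\<And>g. g \<in> carrier G \<Longrightarrow> \<chi> g = r * \<chi>' g"
    and \<chi>': "\<chi>' \<in> hom G real_group"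
    by (auto simp: character_rel_def nonzero_characters_def)
  \<comment> \<open>\<open>\<chi>\<close> vanishes on \<open>S\<close>, while \<open>\<chi>'\<close>
    is the member of the class with coordinates \<open>x\<close>; the positive factor
    \<open>r\<close> carries the zeros over.\<close>
  have "x \<bullet> coord_vec a = 0" if "a \<in> S" for a
    using real_hom_eq_scalar_prod[OF \<chi>'] r \<chi> x(2) that assms by (metis less_irrefl mult_eq_0_iff subsetD)
  then show "x \<in> {x \<in> unit_sphere n. \<forall>a\<in>S. x \<bullet> coord_vec a = 0}" using x(1) by simp
next
  fix x assume "x \<in> {x \<in> unit_sphere n. \<forall>a\<in>S. x \<bullet> coord_vec a = 0}"
  then have x: "x \<in> unit_sphere n" "\<forall>a\<in>S. x \<bullet> coord_vec a = 0" "x \<in> carrier_vec n" "x \<bullet> x = 1"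
    by (auto simp: unit_sphere_def)
  \<comment> \<open>By \<open>real_hom_eq_scalar_prod\<close> this is, on the carrier, the only
    homomorphism with coordinates \<open>x\<close>.\<close>
  let ?\<chi> = "\<lambda>g. x \<bullet> coord_vec g"
  \<comment> \<open>Norm 1 forces a nonzero coordinate, so the homomorphism is nonzero on a basis
    element and defines a point of the sphere.\<close>
  have "\<exists>i<n. x $ i \<noteq> 0"
  proof (rule ccontr)
    assume "\<not> ?thesis"
    then have "x \<bullet> x = 0" using x(3) by (auto simp: scalar_prod_def)
    then show False using x(4) by simp
  qed
  then obtain i where "i < n" "x $ i \<noteq> 0" by blast
  then have "?\<chi> (bs ! i) \<noteq> 0"
    using x(3) by (simp add: coord_vec_basis scalar_prod_right_unit)
  then have \<chi>: "?\<chi> \<in> nonzero_characters G"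
    using scalar_prod_hom[OF x(3)] \<open>i < n\<close> unfolding nonzero_characters_def by auto
  then have "character_class G ?\<chi> \<in> character_subsphere G S"
    using x(2) unfolding character_subsphere_def by blast
  moreover have "?\<chi> \<in> character_class G ?\<chi>"
    using \<chi> by (auto simp: character_rel_def intro: exI[of _ 1])
  ultimately show "x \<in> spherical_coordinates bs (character_subsphere G S)"
    using map_scalar_prod_basis[OF x(3), symmetric] x(1)
    unfolding spherical_coordinates_def mem_Collect_eq by (intro conjI bexI)
qed

text \<open>Stated for finite sets of elements, not for subgroups, so that each intersection
  involves finitely many semi-spheres.\<close>

lemma rational_spherical_polyhedron_subspheres:
  assumes "finite \<S>" "\<And>S. S \<in> \<S> \<Longrightarrow> finite S \<and> S \<subseteq> carrier G"
  shows "rational_spherical_polyhedron n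
    (spherical_coordinates bs (\<Union>S\<in>\<S>. character_subsphere G S))"
proof -
  let ?s = "\<lambda>q. {x \<in> unit_sphere n. x \<bullet> q \<ge> 0}"
  \<comment> \<open>The whole sphere is included so that \<open>F {}\<close> is not empty.\<close>
  define F where "F S = insert (?s (0\<^sub>v n))
    (\<Union>a\<in>S. {?s (coord_vec a), ?s (- coord_vec a)})" for S
  have rat: "rational_semisphere n (?s q)" if "q \<in> carrier_vec n" "\<And>i. i < n \<Longrightarrow> q $ i \<in> \<rat>" for q
    using that unfolding rational_semisphere_def by blast
  have "(\<Inter>(F S)) = spherical_coordinates bs (character_subsphere G S)" if "S \<in> \<S>" for S
  proof -
    \<comment> \<open>The inequalities for \<open>q\<close> and \<open>- q\<close> combine to an
      equation, and the zero vector imposes no condition on the sphere.\<close>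
    have "x \<bullet> (- coord_vec a) = - (x \<bullet> coord_vec a)" "x \<bullet> 0\<^sub>v n = 0" if "x \<in> unit_sphere n" for x a
      using that by (auto simp: unit_sphere_def coord_vec_def)
    then have "(\<Inter>(F S)) = {x \<in> unit_sphere n. \<forall>a\<in>S. x \<bullet> coord_vec a = 0}"
      by (auto simp: F_def intro: antisym)
    then show ?thesis using spherical_coordinates_subsphere that assms(2) by simp
  qed
  moreover have "spherical_coordinates bs (\<Union>S\<in>\<S>. character_subsphere G S) =
      (\<Union>S\<in>\<S>. spherical_coordinates bs (character_subsphere G S))"
    unfolding spherical_coordinates_def by blast
  ultimately have "spherical_coordinates bs (\<Union>S\<in>\<S>. character_subsphere G S) = (\<Union>(F' :: real vec set set)\<in>F ` \<S>. \<Inter>F')"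
    by simp
  moreover have "finite (F S) \<and> F S \<noteq> {} \<and> (\<forall>T\<in>F S. rational_semisphere n T)" if "S \<in> \<S>" for S
    using assms(2)[OF that] by (auto simp: F_def coord_vec_def intro!: rat)
  ultimately show ?thesis
    unfolding rational_spherical_polyhedron_def using assms(1) by (intro exI[of _ "F ` \<S>"]) auto
qed

end

text \<open>Kernels are subgroups. This links the finite sets behind the polyhedron to the subgroups
  in the theorem.\<close>

lemma (in group) character_subsphere_generate:
  assumes "S \<subseteq> carrier G"
  shows "character_subsphere G (generate G S) = character_subsphere G S"
proof -
  have "(\<forall>h\<in>generate G S. \<chi> h = 0) \<longleftrightarrow> (\<forall>h\<in>S. \<chi> h = 0)" if "\<chi> \<in> nonzero_characters G" for \<chi>
    using that real_hom_zero_on_generate[OF _ assms] by (auto simp: nonzero_characters_def generate.incl)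
  then show ?thesis unfolding character_subsphere_def by blast
qed


section \<open>Living subgraphs\<close>

abbreviation (input) living ::
    "'a pair_pre_digraph \<Rightarrow> ('a \<Rightarrow> 'a \<Rightarrow> nat) \<Rightarrow> ('a gword set \<Rightarrow> real) \<Rightarrow> bool" where
  "living \<Gamma> l \<chi> \<equiv> Digraph_Component.connected (with_proj (living_subgraph \<Gamma> l \<chi>)) \<and>
     dominant (living_subgraph \<Gamma> l \<chi>) \<Gamma>"

text \<open>Generators of \<open>H\<^sub>\<chi>\<close>. The product attached to a dead edge turns
  the condition of opposite values at its ends into the vanishing of one element.\<close>

definition vanishing_elements ::
    "'a pair_pre_digraph \<Rightarrow> ('a \<Rightarrow> 'a \<Rightarrow> nat) \<Rightarrow> ('a gword set \<Rightarrow> real) \<Rightarrow> 'a gword set set" where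
  "vanishing_elements \<Gamma> l \<chi> =
     {artin_gen \<Gamma> l v | v. v \<in> pverts \<Gamma> \<and> \<chi> (artin_gen \<Gamma> l v) = 0} \<union>
     {artin_gen \<Gamma> l u \<otimes>\<^bsub>artin_group \<Gamma> l\<^esub> artin_gen \<Gamma> l v | u v. dead_edge \<Gamma> l \<chi> u v}"

lemma artin_gen_closed: "v \<in> pverts \<Gamma> \<Longrightarrow> artin_gen \<Gamma> l v \<in> carrier (artin_group \<Gamma> l)"
  by (auto simp: artin_gen_def artin_group_def presented_group_def intro: quotientI)

text \<open>In this form connectedness reduces to paths that are monotone in vertices and arcs;
  nonemptiness is part of the notion.\<close>

lemma connected_with_proj_iff:
  "Digraph_Component.connected (with_proj H) \<longleftrightarrow> pverts H \<noteq> {} \<and>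
     (\<forall>u\<in>pverts H. \<forall>v\<in>pverts H. (u, v) \<in> rtrancl_on (pverts H) (parcs H \<union> (parcs H)\<inverse>))"
proof -
  have "parcs (mk_symmetric (with_proj H)) = parcs H \<union> (parcs H)\<inverse>"
    by (auto simp: mk_symmetric_def)
  then show ?thesis
    by (simp add: Digraph_Component.connected_def strongly_connected_def reachable_def)
qed

context
  fixes \<Gamma> :: "'a pair_pre_digraph" and l :: "'a \<Rightarrow> 'a \<Rightarrow> nat"
  assumes graph: "pair_graph \<Gamma>"
begin

interpretation pair_graph \<Gamma> by (rule graph)

interpretation G: group "artin_group \<Gamma> l" by (rule group_artin_group)

lemma vanishing_elements_closed: "vanishing_elements \<Gamma> l \<chi> \<subseteq> carrier (artin_group \<Gamma> l)"
  by (auto simp: vanishing_elements_def dead_edge_def artin_gen_closed in_arcsD1 in_arcsD2)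

lemma vanishing_elements_vanish:
  assumes "\<chi> \<in> hom (artin_group \<Gamma> l) real_group" "a \<in> vanishing_elements \<Gamma> l \<chi>"
  shows "\<chi> a = 0"
  using assms G.real_hom_mult[OF assms(1)]
  by (auto simp: vanishing_elements_def dead_edge_def artin_gen_closed in_arcsD1 in_arcsD2)

text \<open>Every such set lies in one finite set \<open>?F\<close>, independent of
  \<open>\<chi>\<close>, so infinitely many characters yield only finitely many sets.\<close>

lemma finite_vanishing_elements: "finite (vanishing_elements \<Gamma> l \<chi>)"
  and finite_range_vanishing_elements: "finite (range (vanishing_elements \<Gamma> l))"
proof -
  let ?F = "artin_gen \<Gamma> l ` pverts \<Gamma> \<union>
    (\<lambda>(u, v). artin_gen \<Gamma> l u \<otimes>\<^bsub>artin_group \<Gamma> l\<^esub> artin_gen \<Gamma> l v) ` parcs \<Gamma>"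
  have sub: "vanishing_elements \<Gamma> l \<chi> \<subseteq> ?F" for \<chi>
    by (force simp: vanishing_elements_def dead_edge_def)
  have fin: "finite ?F"
    by (simp add: pair_finite_verts pair_finite_arcs)
  show "finite (vanishing_elements \<Gamma> l \<chi>)" using sub fin by (rule finite_subset)
  have "range (vanishing_elements \<Gamma> l) \<subseteq> Pow ?F" using sub by blast
  then show "finite (range (vanishing_elements \<Gamma> l))" using fin by (simp add: finite_subset)
qed

lemma living_specialization:
  assumes \<chi>': "\<chi>' \<in> hom (artin_group \<Gamma> l) real_group"
    and van: "\<And>a. a \<in> vanishing_elements \<Gamma> l \<chi> \<Longrightarrow> \<chi>' a = 0"
    and "living \<Gamma> l \<chi>'"
  shows "living \<Gamma> l \<chi>"
proof -
  let ?g = "artin_gen \<Gamma> l" and ?L = "living_subgraph \<Gamma> l \<chi>" and ?L' = "living_subgraph \<Gamma> l \<chi>'"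
  have zero: "\<chi>' (?g v) = 0" if "v \<in> pverts \<Gamma>" "\<chi> (?g v) = 0" for v
    using that by (intro van) (auto simp: vanishing_elements_def)
  have dead: "\<chi>' (?g u) = - \<chi>' (?g v)" if "dead_edge \<Gamma> l \<chi> u v" for u v
  proof -
    have "\<chi>' (?g u \<otimes>\<^bsub>artin_group \<Gamma> l\<^esub> ?g v) = 0"
      using that by (intro van) (auto simp: vanishing_elements_def)
    moreover have "u \<in> pverts \<Gamma>" "v \<in> pverts \<Gamma>"
      using that by (auto simp: dead_edge_def in_arcsD1 in_arcsD2)
    ultimately show ?thesis
      using G.real_hom_mult[OF \<chi>'] by (simp add: artin_gen_closed)
  qed
  have verts: "pverts ?L' \<subseteq> pverts ?L"
    using zero by (auto simp: living_subgraph_def)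
  have arcs: "parcs ?L' \<subseteq> parcs ?L"
  proof clarify
    fix u v assume uv: "(u, v) \<in> parcs ?L'"
    then have *: "(u, v) \<in> parcs \<Gamma>" "\<chi>' (?g u) \<noteq> 0" "\<chi>' (?g v) \<noteq> 0" "\<not> dead_edge \<Gamma> l \<chi>' u v"
      by (auto simp: living_subgraph_def)
    then have "\<chi> (?g u) \<noteq> 0" "\<chi> (?g v) \<noteq> 0" using zero in_arcsD1 in_arcsD2 by blast+
    \<comment> \<open>Being an arc and the conditions on the label do not involve the character, and
      \<open>dead\<close> gives the opposite values. So an edge dead for \<open>\<chi>\<close> is
      dead for \<open>\<chi>'\<close>.\<close>
    moreover have "\<not> dead_edge \<Gamma> l \<chi> u v" using dead *(4) by (auto simp: dead_edge_def)
    ultimately show "(u, v) \<in> parcs ?L" using *(1) by (simp add: living_subgraph_def)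
  qed
  have dom': "\<exists>w\<in>pverts ?L'. (v, w) \<in> parcs \<Gamma>" if "v \<in> pverts \<Gamma>" "v \<notin> pverts ?L'" for v
    using assms(3) that by (auto simp: dominant_def)
  have "dominant ?L \<Gamma>"
    \<comment> \<open>A vertex outside \<open>?L\<close> is outside \<open>?L'\<close>, so it has a
      neighbour in \<open>?L'\<close>, which also lies in \<open>?L\<close>.\<close>
    unfolding dominant_def using dom' verts by blast
  moreover have "Digraph_Component.connected (with_proj ?L)"
  proof -
    have arcs_sym: "parcs ?L' \<union> (parcs ?L')\<inverse> \<subseteq> parcs ?L \<union> (parcs ?L)\<inverse>"
      using arcs by blast
    let ?R = "rtrancl_on (pverts ?L) (parcs ?L \<union> (parcs ?L)\<inverse>)"
    have conn': "pverts ?L' \<noteq> {}"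
      "\<And>u v. u \<in> pverts ?L' \<Longrightarrow> v \<in> pverts ?L' \<Longrightarrow> (u, v) \<in> ?R"
      using assms(3) rtrancl_on_mono[OF arcs_sym verts] unfolding connected_with_proj_iff
      by blast+
    have symR: "(v, u) \<in> ?R" if "(u, v) \<in> ?R" for u v
      using rtrancl_on_sym[of "parcs ?L \<union> (parcs ?L)\<inverse>"] that by (auto simp: sym_def)
    \<comment> \<open>Joining each vertex to the connected core \<open>?L'\<close> suffices: two
      such paths and one between their ends in the core compose.\<close>
    have "\<exists>w\<in>pverts ?L'. (v, w) \<in> ?R" if v: "v \<in> pverts ?L" for v
    proof (cases "v \<in> pverts ?L'")
      case True
      then show ?thesis using v by (auto intro: rtrancl_on_refl)
    next
      case False
      have v': "v \<in> pverts \<Gamma>" "\<chi> (?g v) \<noteq> 0" using v by (auto simp: living_subgraph_def)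
      then obtain w where w: "w \<in> pverts ?L'" "(v, w) \<in> parcs \<Gamma>" using dom' False by blast
      have "\<chi>' (?g v) = 0" "\<chi>' (?g w) \<noteq> 0" "\<chi> (?g w) \<noteq> 0"
        using False v' w verts by (auto simp: living_subgraph_def)
      then have "\<not> dead_edge \<Gamma> l \<chi> v w" using dead by fastforce
      then have "(v, w) \<in> parcs ?L"
        using v' w \<open>\<chi> (?g w) \<noteq> 0\<close> by (simp add: living_subgraph_def)
      then have "(v, w) \<in> ?R"
        using v w verts by (auto intro: rtrancl_on_into_rtrancl_on rtrancl_on_refl)
      then show ?thesis using w by blast
    qed
    then have "(u, v) \<in> ?R" if "u \<in> pverts ?L" "v \<in> pverts ?L" for u v
      using that conn'(2) symR by (meson rtrancl_on_trans)
    moreover have "pverts ?L \<noteq> {}" using conn'(1) verts by blast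
    ultimately show ?thesis unfolding connected_with_proj_iff by simp
  qed
  ultimately show ?thesis by blast
qed

text \<open>Proportional characters have the same zeros, so \<open>living_specialization\<close>
  applies. The condition thus depends only on the class.\<close>

lemma living_character_class:
  assumes "(\<chi>, \<chi>') \<in> character_rel (artin_group \<Gamma> l)" "living \<Gamma> l \<chi>'"
  shows "living \<Gamma> l \<chi>"
proof (rule living_specialization[OF _ _ assms(2)])
  obtain r where r: "r > 0" "\<And>g. g \<in> carrier (artin_group \<Gamma> l) \<Longrightarrow> \<chi> g = r * \<chi>' g"
    and hom: "\<chi> \<in> hom (artin_group \<Gamma> l) real_group"
    using assms(1) by (auto simp: character_rel_def nonzero_characters_def)
  show "\<chi>' \<in> hom (artin_group \<Gamma> l) real_group"
    using assms(1) by (auto simp: character_rel_def nonzero_characters_def)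
  show "\<chi>' a = 0" if "a \<in> vanishing_elements \<Gamma> l \<chi>" for a
    using vanishing_elements_vanish[OF hom that] vanishing_elements_closed that r
    by (metis less_irrefl mult_eq_0_iff subsetD)
qed

lemma not_living_eq_Union_subspheres:
  fixes G
  defines "G \<equiv> artin_group \<Gamma> l"
  shows "character_sphere G - {character_class G \<chi> | \<chi>. \<chi> \<in> nonzero_characters G \<and> living \<Gamma> l \<chi>} =
    (\<Union>S\<in>vanishing_elements \<Gamma> l ` {\<chi> \<in> nonzero_characters G. \<not> living \<Gamma> l \<chi>}.
      character_subsphere G S)" (is "_ - ?P = ?U")
proof (intro equalityI subsetI)
  fix c assume c: "c \<in> character_sphere G - ?P"
  then obtain \<chi> where \<chi>: "\<chi> \<in> nonzero_characters G" "c = character_class G \<chi>"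
    by (auto simp: character_sphere_def quotient_def)
  then have "\<not> living \<Gamma> l \<chi>" using c by blast
  \<comment> \<open>A character vanishes on the elements it defines, so its class lies in its own
    subsphere.\<close>
  moreover have "c \<in> character_subsphere G (vanishing_elements \<Gamma> l \<chi>)"
    using \<chi> vanishing_elements_vanish
    by (auto simp: character_subsphere_def nonzero_characters_def G_def)
  ultimately show "c \<in> ?U" using \<chi> by blast
next
  fix c assume "c \<in> ?U"
  then obtain \<chi> \<chi>' where \<chi>: "\<not> living \<Gamma> l \<chi>" "\<forall>a\<in>vanishing_elements \<Gamma> l \<chi>. \<chi>' a = 0"
    and \<chi>': "\<chi>' \<in> nonzero_characters G" "c = character_class G \<chi>'"
    by (auto simp: character_subsphere_def)
  \<comment> \<open>Contrapositive of specialization: failure for \<open>\<chi>\<close> passes to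
    every nonzero character vanishing on its elements.\<close>
  have nl: "\<not> living \<Gamma> l \<chi>'"
    using living_specialization[of \<chi>' \<chi>] \<chi> \<chi>' by (auto simp: nonzero_characters_def G_def)
  \<comment> \<open>Membership in \<open>?P\<close> may be witnessed by another representative
    \<open>\<rho>\<close>, so invariance under rescaling is required.\<close>
  have "c \<notin> ?P"
  proof
    assume "c \<in> ?P"
    then obtain \<rho> where \<rho>: "\<rho> \<in> nonzero_characters G" "living \<Gamma> l \<rho>" "c = character_class G \<rho>"
      by blast
    have "(\<rho>, \<rho>) \<in> character_rel G"
      using \<rho>(1) by (auto simp: character_rel_def intro: exI[of _ 1])
    then have "(\<chi>', \<rho>) \<in> character_rel G" using \<rho>(3) \<chi>'(2) by blast
    then show False using living_character_class \<rho>(2) nl unfolding G_def by blast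
  qed
  then show "c \<in> character_sphere G - ?P"
    using \<chi>' by (auto simp: character_sphere_def intro: quotientI)
qed

end

section \<open>From finite sets of elements to numbered subgroups and to arbitrary bases\<close>

theorem propositionB:
  fixes \<Gamma> :: "'a pair_pre_digraph"
    and l :: "'a \<Rightarrow> 'a \<Rightarrow> nat"
    and G :: "'a gword set monoid"
    and Y :: "'a gword set set"
  assumes "pair_graph \<Gamma>"
    and "\<And>u v. (u, v) \<in> parcs \<Gamma> \<Longrightarrow> l u v = l v u"
    and "\<And>u v. (u, v) \<in> parcs \<Gamma> \<Longrightarrow> l u v \<ge> 2"
    and "G = artin_group \<Gamma> l"
    and "finite Y" and "Y \<subseteq> carrier G" and "generate G Y = carrier G"
    and "Sigma1 G Y = {character_class G \<chi> | \<chi>. \<chi> \<in> nonzero_characters G \<and>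
           Digraph_Component.connected (with_proj (living_subgraph \<Gamma> l \<chi>)) \<and>
           dominant (living_subgraph \<Gamma> l \<chi>) \<Gamma>}"
  shows "(\<exists>(s::nat) H. (\<forall>i\<in>{1..s}. subgroup (H i) G) \<and>
           character_sphere G - Sigma1 G Y = (\<Union>i\<in>{1..s}. character_subsphere G (H i))) \<and>
         (\<forall>bs. basis_mod_torsion G bs \<longrightarrow>
           rational_spherical_polyhedron (length bs)
             (spherical_coordinates bs (character_sphere G - Sigma1 G Y)))"
proof -
  interpret G: group G unfolding assms(4) by (rule group_artin_group)
  define \<S> where
    "\<S> = vanishing_elements \<Gamma> l ` {\<chi> \<in> nonzero_characters G. \<not> living \<Gamma> l \<chi>}"
  have compl: "character_sphere G - Sigma1 G Y = (\<Union>S\<in>\<S>. character_subsphere G S)"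
    unfolding assms(8) \<S>_def
    using not_living_eq_Union_subspheres[OF assms(1), of l, folded assms(4)] .
  have fin: "finite \<S>"
    using finite_range_vanishing_elements[OF assms(1), of l] unfolding \<S>_def
    by (rule finite_subset[rotated]) blast
  have sub: "finite S \<and> S \<subseteq> carrier G" if "S \<in> \<S>" for S
    using that finite_vanishing_elements[OF assms(1)] vanishing_elements_closed[OF assms(1)]
    unfolding \<S>_def assms(4) by blast
  \<comment> \<open>Numbering starts at 1; if \<open>\<S>\<close> is empty, then
    \<open>s = 0\<close> and the union is empty.\<close>
  obtain h where "bij_betw h {1..card \<S>} \<S>"
    using ex_bij_betw_nat_finite_1[OF fin] by blast
  then have h: "\<S> = h ` {1..card \<S>}" by (simp add: bij_betw_def)
  have hsub: "h i \<subseteq> carrier G" if "i \<in> {1..card \<S>}" for i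
    using sub h that by blast
  let ?H = "\<lambda>i. generate G (h i)"
  have "character_sphere G - Sigma1 G Y = (\<Union>i\<in>{1..card \<S>}. character_subsphere G (h i))"
    unfolding compl by (subst h) simp
  also have "\<dots> = (\<Union>i\<in>{1..card \<S>}. character_subsphere G (?H i))"
    using G.character_subsphere_generate[OF hsub] by simp
  finally have "(\<forall>i\<in>{1..card \<S>}. subgroup (?H i) G) \<and>
      character_sphere G - Sigma1 G Y = (\<Union>i\<in>{1..card \<S>}. character_subsphere G (?H i))"
    using G.generate_is_subgroup hsub by simp
  then have "\<exists>(s::nat) H. (\<forall>i\<in>{1..s}. subgroup (H i) G) \<and>
      character_sphere G - Sigma1 G Y = (\<Union>i\<in>{1..s}. character_subsphere G (H i))"
    by (intro exI)
  moreover have "rational_spherical_polyhedron (length bs)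
      (spherical_coordinates bs (character_sphere G - Sigma1 G Y))" if "basis_mod_torsion G bs" for bs
  proof -
    interpret group_with_basis G bs using that by unfold_locales
    show ?thesis unfolding compl
      using fin sub by (rule rational_spherical_polyhedron_subspheres)
  qed
  ultimately show ?thesis
    by simp
qed

end
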